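(* Let $q$ be a power of an odd prime, let $n\ge 2$, and let $\mathcal{N}\subseteq\mathbb{F}_q^n$ be a conical Nikodym set. Then $$|\mathcal{N}|\ge\left(3+\frac{4}{q-2}\right)^{-n}q^n=(3+o(1))^{-n}q^n\quad (q\to\infty).$$
   Context: Fix a non-square $g\in\mathbb{F}_q^*$. For vectors $\underline{a},\underline{b},\underline{c}\in\mathbb{F}_q^n$ with $\underline{b},\underline{c}$ linearly independent, define: (H) a hyperbola $\mathcal{H}=\{\underline{a}+t\underline{b}+t^{-1}\underline{c}: t\in\mathbb{F}_q^*\}$; (P) a parabola $\mathcal{P}=\{\underline{a}+t\underline{b}+t^{2}\underline{c}: t\in\mathbb{F}_q\}$; (E) an ellipse $\mathcal{E}=\{\underline{a}+x\underline{b}+y\underline{c}: (x,y)\in\mathbb{F}_q^2,\ y^2=gx^2+k\}$ for some $k\in\mathbb{F}_q^*$. A set $\mathcal{N}\subseteq\mathbb{F}_q^n$ is a conical Nikodym set if for every $\underline{x}\in\mathbb{F}_q^n$ there is a set $\mathcal{C}$ of one of the forms (H), (P), (E) with $\underline{x}\in\mathcal{C}$ and $\mathcal{C}\setminus\{\underline{x}\}\subseteq\mathcal{N}$. *)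

theory Defs
  imports "HOL-Analysis.Analysis" "HOL-Library.Landau_Symbols"
    "HOL-Computational_Algebra.Computational_Algebra"
begin

text \<open>
  A finite field of order \<open>q\<close> is a type \<open>'a :: {field, finite}\<close> with \<open>CARD('a) = q\<close>, and its
  \<open>n\<close>-dimensional coordinate space is \<open>'a ^ 'n\<close> with \<open>CARD('n) = n\<close>.
\<close>

text \<open>Independence of the pair, not merely of the set: \<open>vec.independent {b, b}\<close> may hold.\<close>

definition lin_indep_pair :: "'a::field ^ 'n \<Rightarrow> 'a ^ 'n \<Rightarrow> bool" where
  "lin_indep_pair b c \<longleftrightarrow> b \<noteq> c \<and> vec.independent {b, c}"

definition is_hyperbola :: "('a::field ^ 'n) set \<Rightarrow> bool" where
  "is_hyperbola C \<longleftrightarrow>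
     (\<exists>a b c. lin_indep_pair b c \<and> C = {a + t *s b + inverse t *s c | t. t \<noteq> 0})"

definition is_parabola :: "('a::field ^ 'n) set \<Rightarrow> bool" where
  "is_parabola C \<longleftrightarrow>
     (\<exists>a b c. lin_indep_pair b c \<and> C = {a + t *s b + t\<^sup>2 *s c | t. True})"

definition is_ellipse :: "'a::field \<Rightarrow> ('a ^ 'n) set \<Rightarrow> bool" where
  "is_ellipse g C \<longleftrightarrow>
     (\<exists>a b c k. lin_indep_pair b c \<and> k \<noteq> 0 \<and>
        C = {a + x *s b + y *s c | x y. y\<^sup>2 = g * x\<^sup>2 + k})"

definition conical_Nikodym_set :: "'a::field \<Rightarrow> ('a ^ 'n) set \<Rightarrow> bool" where
  "conical_Nikodym_set g N \<longleftrightarrow>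
     (\<forall>x. \<exists>C. (is_hyperbola C \<or> is_parabola C \<or> is_ellipse g C) \<and> x \<in> C \<and> C - {x} \<subseteq> N)"

end

theory Submission
  imports Defs "HOL-Real_Asymp.Real_Asymp"
begin

text \<open>
  Polynomial method with multiplicities. If \<open>N\<close> is small, some nonzero \<open>P\<close> of degree at most \<open>d\<close>
  vanishes to order \<open>m\<close> on \<open>N\<close>. A conic through \<open>x\<close> is a curve \<open>A(t) / D(t)\<close> with \<open>A\<close>, \<open>D\<close> of degree
  at most \<open>2\<close> that meets \<open>N\<close> at \<open>q - 2\<close> or more parameters. A Hasse derivative \<open>P'\<close> of \<open>P\<close> of order \<open>w\<close>
  vanishes to order \<open>m - w\<close> on \<open>N\<close>, so \<open>D^d P'(A / D)\<close>, of degree at most \<open>2 d\<close>, is zero when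
  \<open>(q - 2) (m - w) > 2 d\<close>, whence \<open>P'(x) = 0\<close>. Thus \<open>P\<close> vanishes to a high order \<open>l\<close> everywhere,
  which is impossible for \<open>d < l q\<close>. Taking \<open>l = (q - 2) s\<close>, \<open>m = (3 q - 2) s\<close>, \<open>d = l q - 1\<close> and
  \<open>s \<rightarrow> \<infinity>\<close> gives the bound.

  The impossibility of vanishing to order \<open>l\<close> everywhere becomes a triangularity statement when \<open>P\<close> is
  expanded in products of the univariate polynomials \<open>\<phi>\<^sub>k = (X - a\<^sub>0) \<dots> (X - a\<^sub>k\<^sub>-\<^sub>1)\<close>, where \<open>a\<close> runs
  periodically through the field: at \<open>a\<^sub>k\<close>, \<open>\<phi>\<^sub>k\<close> vanishes to order exactly \<open>k div q\<close> and every
  later \<open>\<phi>\<close> to a higher order.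
\<close>

subsection \<open>Taylor coefficients, Hasse derivatives and homogenisation\<close>

definition taylor_coeff :: "'a::field poly \<Rightarrow> 'a \<Rightarrow> nat \<Rightarrow> 'a" where
  "taylor_coeff f x i = coeff (pcompose f [:x, 1:]) i"

text \<open>The formal \<open>w\<close>-th derivative divided by \<open>w!\<close>; the binomial
  form stays meaningful when the characteristic divides \<open>w!\<close>.\<close>

definition hasse_deriv :: "nat \<Rightarrow> 'a::field poly \<Rightarrow> 'a poly" where
  "hasse_deriv w f = (\<Sum>k\<le>degree f. monom (of_nat ((k + w) choose w) * coeff f (k + w)) k)"

text \<open>For \<open>N\<close> at least the degree of \<open>f\<close> this is
  \<open>D ^ N * f(A / D)\<close> with denominators cleared.\<close>

definition homog :: "nat \<Rightarrow> 'a::field poly \<Rightarrow> 'a poly \<Rightarrow> 'a poly \<Rightarrow> 'a poly" where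
  "homog N f A D = (\<Sum>k\<le>N. smult (coeff f k) (A ^ k * D ^ (N - k)))"

lemma smult_sum_right: "smult a (\<Sum>i\<in>I. f i) = (\<Sum>i\<in>I. smult a (f i))"
  by (rule poly_eqI) (simp add: coeff_sum sum_distrib_left)

lemma pcompose_power: "pcompose (f ^ n) r = pcompose f r ^ n"
  for f :: "'a::comm_ring_1 poly"
  by (induction n) (simp_all add: pcompose_mult pcompose_1)

lemma coeff_hasse_deriv:
  "coeff (hasse_deriv w f) i = of_nat ((i + w) choose w) * coeff f (i + w)"
  by (auto simp: hasse_deriv_def coeff_sum coeff_eq_0)

lemma degree_hasse_deriv_le: "degree (hasse_deriv w f) \<le> degree f"
  by (rule degree_le) (auto simp: coeff_hasse_deriv coeff_eq_0)

lemma taylor_coeff_eq_sum: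
  assumes "degree f \<le> N"
  shows "taylor_coeff f x i = (\<Sum>k\<le>N. coeff f k * of_nat (k choose i) * x ^ (k - i))"
proof -
  have lin: "coeff ([:x, 1:] ^ k) i = of_nat (k choose i) * x ^ (k - i)" for k
  proof (cases "i \<le> k")
    case True
    then show ?thesis by (simp add: coeff_linear_poly_power)
  next
    case False
    then show ?thesis using degree_power_le[of "[:x, 1:]" k]
      by (auto simp: binomial_eq_0 intro!: coeff_eq_0)
  qed
  have "pcompose f [:x, 1:] = (\<Sum>k\<le>N. pcompose (monom (coeff f k) k) [:x, 1:])"
    by (simp flip: pcompose_sum add: poly_as_sum_of_monoms'[OF assms])
  also have "\<dots> = (\<Sum>k\<le>N. smult (coeff f k) ([:x, 1:] ^ k))"
    by (simp add: monom_altdef pcompose_smult pcompose_power pcompose_pCons)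
  finally show ?thesis
    by (simp add: taylor_coeff_def coeff_sum lin mult.assoc)
qed

lemma taylor_coeff_eq_0:
  assumes "degree f < i"
  shows "taylor_coeff f x i = 0"
  using degree_pcompose_le[of f "[:x, 1:]"] assms
  by (auto simp: taylor_coeff_def intro!: coeff_eq_0)

lemma taylor_coeff_0: "taylor_coeff f x 0 = poly f x"
  by (simp add: taylor_coeff_def)

text \<open>Coefficients match by C(k+w, w) C(k, i) = C(k+w, i+w) C(i+w, w). The index shift shows
  that a vanishing order drops by at most \<open>w\<close>.\<close>

lemma taylor_coeff_hasse_deriv:
  "taylor_coeff (hasse_deriv w f) x i = of_nat ((i + w) choose w) * taylor_coeff f x (i + w)"
proof -
  define N where "N = degree f"
  have "taylor_coeff (hasse_deriv w f) x i
      = (\<Sum>k\<le>N. of_nat ((k + w) choose w) * coeff f (k + w) * of_nat (k choose i) * x ^ (k - i))"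
    using taylor_coeff_eq_sum[OF degree_hasse_deriv_le] by (simp add: coeff_hasse_deriv N_def)
  also have "\<dots> = (\<Sum>k\<le>N. of_nat ((i + w) choose w) *
      (coeff f (k + w) * of_nat ((k + w) choose (i + w)) * x ^ (k - i)))"
  proof (rule sum.cong[OF refl])
    fix k
    have "((k + w) choose w) * (k choose i) = ((k + w) choose (i + w)) * ((i + w) choose w)"
    proof (cases "i \<le> k")
      case True
      then show ?thesis using choose_mult[of w "i + w" "k + w"] by simp
    qed (simp add: binomial_eq_0)
    then have "(of_nat ((k + w) choose w) * of_nat (k choose i) :: 'a)
        = of_nat ((k + w) choose (i + w)) * of_nat ((i + w) choose w)"
      by (metis of_nat_mult)
    then show "of_nat ((k + w) choose w) * coeff f (k + w) * of_nat (k choose i) * x ^ (k - i)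
        = of_nat ((i + w) choose w) *
          (coeff f (k + w) * of_nat ((k + w) choose (i + w)) * x ^ (k - i))"
      by (simp add: ac_simps)
  qed
  also have "\<dots> = of_nat ((i + w) choose w) *
      (\<Sum>k\<in>(\<lambda>k. k + w) ` {..N}. coeff f k * of_nat (k choose (i + w)) * x ^ (k - (i + w)))"
    by (simp add: sum_distrib_left sum.reindex)
  also have "(\<Sum>k\<in>(\<lambda>k. k + w) ` {..N}. coeff f k * of_nat (k choose (i + w)) * x ^ (k - (i + w)))
      = (\<Sum>k\<le>N + w. coeff f k * of_nat (k choose (i + w)) * x ^ (k - (i + w)))"
  proof (rule sum.mono_neutral_left)
    show "\<forall>k\<in>{..N + w} - (\<lambda>k. k + w) ` {..N}.
        coeff f k * of_nat (k choose (i + w)) * x ^ (k - (i + w)) = 0"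
    proof
      fix k assume k: "k \<in> {..N + w} - (\<lambda>k. k + w) ` {..N}"
      have "k < w"
      proof (rule ccontr)
        assume "\<not> k < w"
        then have "k = (k - w) + w" "k - w \<le> N" using k by auto
        then show False using k by blast
      qed
      then show "coeff f k * of_nat (k choose (i + w)) * x ^ (k - (i + w)) = 0"
        by (simp add: binomial_eq_0)
    qed
  qed auto
  also have "\<dots> = taylor_coeff f x (i + w)"
    by (rule taylor_coeff_eq_sum[symmetric]) (simp add: N_def)
  finally show ?thesis .
qed

lemma poly_hasse_deriv: "poly (hasse_deriv w f) x = taylor_coeff f x w"
  using taylor_coeff_hasse_deriv[of w f x 0] by (simp add: taylor_coeff_0)

lemma poly_homog:
  assumes "degree f \<le> N" and "poly A t = x * poly D t"
  shows "poly (homog N f A D) t = poly D t ^ N * poly f x"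
proof -
  have "poly (homog N f A D) t = (\<Sum>k\<le>N. coeff f k * (x * poly D t) ^ k * poly D t ^ (N - k))"
    by (simp add: homog_def poly_sum assms(2) mult.assoc)
  also have "\<dots> = (\<Sum>k\<le>N. poly D t ^ N * (coeff f k * x ^ k))"
    by (rule sum.cong[OF refl]) (simp add: power_mult_distrib ac_simps flip: power_add)
  also have "\<dots> = poly D t ^ N * poly (\<Sum>k\<le>N. monom (coeff f k) k) x"
    by (simp add: poly_sum poly_monom sum_distrib_left)
  finally show ?thesis by (simp add: poly_as_sum_of_monoms'[OF assms(1)])
qed

lemma degree_homog_le:
  assumes "degree A \<le> e" and "degree D \<le> e"
  shows "degree (homog N f A D) \<le> e * N"
  unfolding homog_def
proof (rule degree_sum_le)
  fix k assume "k \<in> {..N}"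
  have "degree (A ^ k) \<le> e * k" "degree (D ^ (N - k)) \<le> e * (N - k)"
    using degree_power_le[of A k] degree_power_le[of D "N - k"] assms
    by (meson le_trans mult_le_mono1)+
  then have "degree (A ^ k * D ^ (N - k)) \<le> e * k + e * (N - k)"
    using degree_mult_le[of "A ^ k" "D ^ (N - k)"] by linarith
  also have "\<dots> = e * N" using \<open>k \<in> {..N}\<close> by (simp flip: add_mult_distrib2)
  finally show "degree (smult (coeff f k) (A ^ k * D ^ (N - k))) \<le> e * N"
    using degree_smult_le order_trans by blast
qed simp

text \<open>With A = y D + H one has A / D = y + H / D, so this is the Taylor expansion of
  \<open>f\<close> at \<open>y\<close> multiplied by \<open>D ^ N\<close>. A root of
  \<open>H\<close> has multiplicity at least \<open>i\<close> in the \<open>i\<close>-th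
  term.\<close>

lemma homog_taylor:
  assumes "degree f \<le> N"
  shows "homog N f (smult y D + H) D = (\<Sum>i\<le>N. smult (taylor_coeff f y i) (H ^ i * D ^ (N - i)))"
proof -
  have "homog N f (smult y D + H) D = (\<Sum>k\<le>N. \<Sum>i\<le>N.
      smult (coeff f k * of_nat (k choose i) * y ^ (k - i)) (H ^ i * D ^ (N - i)))"
    unfolding homog_def
  proof (rule sum.cong[OF refl])
    fix k assume k: "k \<in> {..N}"
    have "(smult y D + H) ^ k * D ^ (N - k)
        = (\<Sum>i\<le>k. smult (of_nat (k choose i) * y ^ (k - i)) (H ^ i * D ^ (N - i)))"
    proof -
      have "(smult y D + H) ^ k = (\<Sum>i\<le>k. of_nat (k choose i) * H ^ i * (smult y D) ^ (k - i))"
        by (subst add.commute) (rule binomial_ring)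
      then have "(smult y D + H) ^ k * D ^ (N - k)
          = (\<Sum>i\<le>k. of_nat (k choose i) * H ^ i * (smult y D) ^ (k - i) * D ^ (N - k))"
        by (simp add: sum_distrib_right)
      also have "\<dots> = (\<Sum>i\<le>k. smult (of_nat (k choose i) * y ^ (k - i)) (H ^ i * D ^ (N - i)))"
      proof (rule sum.cong[OF refl])
        fix i assume "i \<in> {..k}"
        then have "D ^ (k - i) * D ^ (N - k) = D ^ (N - i)"
          using k by (simp flip: power_add)
        then show "of_nat (k choose i) * H ^ i * (smult y D) ^ (k - i) * D ^ (N - k)
            = smult (of_nat (k choose i) * y ^ (k - i)) (H ^ i * D ^ (N - i))"
          by (simp add: smult_power of_nat_poly ac_simps)
      qed
      finally show ?thesis .
    qed
    also have "\<dots> = (\<Sum>i\<le>N. smult (of_nat (k choose i) * y ^ (k - i)) (H ^ i * D ^ (N - i)))"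
      using k by (intro sum.mono_neutral_left) (auto simp: binomial_eq_0)
    finally show "smult (coeff f k) ((smult y D + H) ^ k * D ^ (N - k)) = (\<Sum>i\<le>N.
        smult (coeff f k * of_nat (k choose i) * y ^ (k - i)) (H ^ i * D ^ (N - i)))"
      by (simp add: smult_sum_right mult.assoc)
  qed
  also have "\<dots> = (\<Sum>i\<le>N. smult (taylor_coeff f y i) (H ^ i * D ^ (N - i)))"
    by (subst sum.swap) (simp add: taylor_coeff_eq_sum[OF assms] smult_sum)
  finally show ?thesis .
qed

subsection \<open>Polynomials in several variables restricted to a curve\<close>

definition multi_idx :: "nat \<Rightarrow> ('n::finite \<Rightarrow> nat) set" where
  "multi_idx d = {E. sum E UNIV \<le> d}"

text \<open>The coefficient of \<open>Z\<^sup>w\<close> in \<open>P(x + Z)\<close>, where \<open>P\<close> is the combination with coefficients \<open>c\<close> of the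
  products \<open>\<Prod>j. \<phi> (E j) (X\<^sub>j)\<close>. If \<open>degree (\<phi> k) \<le> k\<close>, then \<open>P\<close> has total degree at most \<open>d\<close>.\<close>

definition mv_taylor ::
  "(nat \<Rightarrow> 'a::field poly) \<Rightarrow> (('n::finite \<Rightarrow> nat) \<Rightarrow> 'a) \<Rightarrow> nat \<Rightarrow> ('n \<Rightarrow> 'a) \<Rightarrow> ('n \<Rightarrow> nat) \<Rightarrow> 'a"
  where "mv_taylor \<phi> c d x w =
    (\<Sum>E\<in>multi_idx d. c E * (\<Prod>j\<in>UNIV. taylor_coeff (\<phi> (E j)) (x j) (w j)))"

lemma multi_idx_subset: "multi_idx d \<subseteq> (UNIV \<rightarrow>\<^sub>E {..d})"
proof
  fix E :: "'a \<Rightarrow> nat" assume E: "E \<in> multi_idx d"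
  have "E j \<le> d" for j
    using member_le_sum[of j UNIV E] E by (simp add: multi_idx_def)
  then show "E \<in> UNIV \<rightarrow>\<^sub>E {..d}" by auto
qed

lemma finite_multi_idx [simp]: "finite (multi_idx d :: ('n::finite \<Rightarrow> nat) set)"
  using multi_idx_subset by (rule finite_subset) (simp add: finite_PiE)

lemma smult_prod: "(\<Prod>j\<in>J. smult (a j) (f j)) = smult (\<Prod>j\<in>J. a j) (\<Prod>j\<in>J. f j)"
  for f :: "'b \<Rightarrow> 'a::comm_semiring_1 poly"
  by (induction J rule: infinite_finite_induct) (auto simp: ac_simps)

text \<open>The expansions of \<open>homog_taylor\<close> are multiplied out over the coordinates.
  The factor \<open>D ^ (d - sum E UNIV)\<close> makes the powers of \<open>H\<close> and
  \<open>D\<close> on the right independent of \<open>E\<close>, so combinations over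
  \<open>E\<close> can be collected term by term.\<close>

lemma prod_homog_taylor:
  fixes \<psi> A :: "'n::finite \<Rightarrow> 'a::field poly" and E :: "'n \<Rightarrow> nat"
  assumes deg: "\<And>j. degree (\<psi> j) \<le> E j" and E: "sum E UNIV \<le> d"
  shows "D ^ (d - sum E UNIV) * (\<Prod>j\<in>UNIV. homog (E j) (\<psi> j) (smult (y j) D + H j) D) =
    (\<Sum>I\<in>multi_idx d. smult (\<Prod>j\<in>UNIV. taylor_coeff (\<psi> j) (y j) (I j))
       ((\<Prod>j\<in>UNIV. H j ^ I j) * D ^ (d - sum I UNIV)))"
    (is "_ = (\<Sum>I\<in>_. ?term I)")
proof -
  define L where "L = {I. \<forall>j. I j \<le> E j}"
  have L: "L = PiE UNIV (\<lambda>j. {..E j})" by (auto simp: L_def)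
  have "(\<Prod>j\<in>UNIV. homog (E j) (\<psi> j) (smult (y j) D + H j) D)
      = (\<Prod>j\<in>UNIV. \<Sum>i\<le>E j. smult (taylor_coeff (\<psi> j) (y j) i) (H j ^ i * D ^ (E j - i)))"
    by (simp add: homog_taylor[OF deg])
  also have "\<dots> = (\<Sum>I\<in>L. \<Prod>j\<in>UNIV.
      smult (taylor_coeff (\<psi> j) (y j) (I j)) (H j ^ I j * D ^ (E j - I j)))"
    by (simp add: prod_sum_PiE L)
  finally have "D ^ (d - sum E UNIV) * (\<Prod>j\<in>UNIV. homog (E j) (\<psi> j) (smult (y j) D + H j) D)
      = (\<Sum>I\<in>L. D ^ (d - sum E UNIV) * (\<Prod>j\<in>UNIV.
          smult (taylor_coeff (\<psi> j) (y j) (I j)) (H j ^ I j * D ^ (E j - I j))))"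
    by (simp add: sum_distrib_left)
  also have "\<dots> = (\<Sum>I\<in>L. ?term I)"
  proof (rule sum.cong[OF refl])
    fix I assume "I \<in> L"
    then have le: "I j \<le> E j" for j by (simp add: L_def)
    have "(\<Sum>j\<in>UNIV. E j - I j) = sum E UNIV - sum I UNIV"
      by (rule sum_subtractf_nat) (simp add: le)
    moreover have "sum I UNIV \<le> sum E UNIV" by (simp add: sum_mono le)
    ultimately have pow: "D ^ (d - sum E UNIV) * (\<Prod>j\<in>UNIV. D ^ (E j - I j)) = D ^ (d - sum I UNIV)"
      using E by (simp flip: power_sum power_add)
    show "D ^ (d - sum E UNIV) * (\<Prod>j\<in>UNIV.
        smult (taylor_coeff (\<psi> j) (y j) (I j)) (H j ^ I j * D ^ (E j - I j))) = ?term I"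
      by (simp only: smult_prod prod.distrib mult_smult_right pow[symmetric] mult.left_commute)
  qed
  \<comment> \<open>Enlarging the box \<open>L\<close> to an index set independent of
    \<open>E\<close> adds only terms with some \<open>I j > E j\<close>, whose Taylor coefficient
    lies beyond the degree of \<open>\<psi> j\<close>.\<close>
  also have "\<dots> = (\<Sum>I\<in>multi_idx d. ?term I)"
  proof (rule sum.mono_neutral_left)
    show "L \<subseteq> multi_idx d"
    proof
      fix I assume "I \<in> L"
      then have "sum I UNIV \<le> sum E UNIV" by (intro sum_mono) (simp add: L_def)
      then show "I \<in> multi_idx d" using E by (simp add: multi_idx_def)
    qed
    show "\<forall>I\<in>multi_idx d - L. ?term I = 0"
    proof
      fix I :: "'n \<Rightarrow> nat" assume "I \<in> multi_idx d - L"
      then obtain j where "E j < I j" by (auto simp: L_def not_le)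
      then have "taylor_coeff (\<psi> j) (y j) (I j) = 0"
        using deg[of j] by (intro taylor_coeff_eq_0) simp
      then have "(\<Prod>j\<in>UNIV. taylor_coeff (\<psi> j) (y j) (I j)) = 0"
        by (metis UNIV_I finite prod_zero)
      then show "?term I = 0" by simp
    qed
  qed simp
  finally show ?thesis .
qed

text \<open>Root counting: the Hasse derivative of order \<open>w\<close>, pulled back to the curve,
  has degree at most \<open>e * d\<close> but a root of order at least \<open>m - sum w UNIV\<close>
  at each element of \<open>T\<close>, so it is zero. Its value at \<open>t0\<close> is
  \<open>poly D t0 ^ d\<close> times the Taylor coefficient in question.\<close>

lemma mv_taylor_eq_0_on_curve:
  fixes A :: "'n::finite \<Rightarrow> 'a::{field, finite} poly"
  assumes deg: "\<And>k. degree (\<phi> k) \<le> k"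
    and degA: "\<And>j. degree (A j) \<le> e" and degD: "degree D \<le> e"
    and T: "\<And>\<tau>. \<tau> \<in> T \<Longrightarrow> \<exists>y. (\<forall>j. poly (A j) \<tau> = y j * poly D \<tau>) \<and>
        (\<forall>i. sum i UNIV < m \<longrightarrow> mv_taylor \<phi> c d y i = 0)"
    and x: "poly D t0 \<noteq> 0" "\<And>j. poly (A j) t0 = x j * poly D t0"
    and less: "e * d < card T * (m - sum w UNIV)"
  shows "mv_taylor \<phi> c d x w = 0"
proof -
  define M where "M = m - sum w UNIV"
  define \<psi> where "\<psi> E j = hasse_deriv (w j) (\<phi> (E j))" for E :: "'n \<Rightarrow> nat" and j
  have deg\<psi>: "degree (\<psi> E j) \<le> E j" for E j
    unfolding \<psi>_def using degree_hasse_deriv_le deg order_trans by blast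
  \<comment> \<open>\<open>G\<close> is D^d P'(A / D), with P' the Hasse derivative of multi-order
    \<open>w\<close>.\<close>
  define G where "G = (\<Sum>E\<in>multi_idx d. smult (c E)
    (D ^ (d - sum E UNIV) * (\<Prod>j\<in>UNIV. homog (E j) (\<psi> E j) (A j) D)))"
  have degG: "degree G \<le> e * d"
    unfolding G_def
  proof (rule degree_sum_le)
    fix E :: "'n \<Rightarrow> nat" assume E: "E \<in> multi_idx d"
    have "degree (D ^ (d - sum E UNIV)) \<le> e * (d - sum E UNIV)"
      using degree_power_le[of D "d - sum E UNIV"] degD by (meson le_trans mult_le_mono1)
    moreover have "degree (\<Prod>j\<in>UNIV. homog (E j) (\<psi> E j) (A j) D) \<le> (\<Sum>j\<in>UNIV. e * E j)"
      by (rule order_trans[OF degree_prod_sum_le])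
        (auto intro!: sum_mono degree_homog_le degA degD)
    ultimately have "degree (D ^ (d - sum E UNIV) * (\<Prod>j\<in>UNIV. homog (E j) (\<psi> E j) (A j) D))
        \<le> e * (d - sum E UNIV) + e * sum E UNIV"
      by (intro order_trans[OF degree_mult_le] add_mono) (simp_all add: sum_distrib_left)
    also have "\<dots> = e * d"
      using E by (simp add: multi_idx_def flip: add_mult_distrib2)
    finally show "degree (smult (c E)
        (D ^ (d - sum E UNIV) * (\<Prod>j\<in>UNIV. homog (E j) (\<psi> E j) (A j) D))) \<le> e * d"
      using degree_smult_le order_trans by blast
  qed simp
  have dvd: "[:- \<tau>, 1:] ^ M dvd G" if \<tau>: "\<tau> \<in> T" for \<tau>
  proof -
    obtain y where y: "\<And>j. poly (A j) \<tau> = y j * poly D \<tau>"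
      and van: "\<And>i. sum i UNIV < m \<Longrightarrow> mv_taylor \<phi> c d y i = 0"
      using T[OF \<tau>] by blast
    define H where "H j = A j - smult (y j) D" for j
    have A: "A j = smult (y j) D + H j" for j by (simp add: H_def)
    have H: "[:- \<tau>, 1:] dvd H j" for j
      by (simp add: H_def y flip: poly_eq_0_iff_dvd)
    have "G = (\<Sum>E\<in>multi_idx d. \<Sum>I\<in>multi_idx d. smult (c E * (\<Prod>j\<in>UNIV. taylor_coeff (\<psi> E j) (y j) (I j)))
         ((\<Prod>j\<in>UNIV. H j ^ I j) * D ^ (d - sum I UNIV)))"
      unfolding G_def A
      by (rule sum.cong[OF refl], subst prod_homog_taylor)
        (auto simp: deg\<psi> multi_idx_def smult_sum_right)
    also have "\<dots> = (\<Sum>I\<in>multi_idx d. smult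
         (\<Sum>E\<in>multi_idx d. c E * (\<Prod>j\<in>UNIV. taylor_coeff (\<psi> E j) (y j) (I j)))
         ((\<Prod>j\<in>UNIV. H j ^ I j) * D ^ (d - sum I UNIV)))"
      by (subst sum.swap) (simp add: smult_sum)
    also have "[:- \<tau>, 1:] ^ M dvd \<dots>"
    proof (rule dvd_sum)
      fix I :: "'n \<Rightarrow> nat" assume "I \<in> multi_idx d"
      \<comment> \<open>If \<open>sum I UNIV < M\<close>, the coefficient is a multiple of one of
        order below \<open>m\<close> at \<open>y\<close>, hence zero; otherwise the product of the
        \<open>H j ^ I j\<close> supplies \<open>M\<close> linear factors.\<close>
      have "(\<Sum>E\<in>multi_idx d. c E * (\<Prod>j\<in>UNIV. taylor_coeff (\<psi> E j) (y j) (I j)))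
          = (\<Prod>j\<in>UNIV. of_nat ((I j + w j) choose w j)) * mv_taylor \<phi> c d y (\<lambda>j. I j + w j)"
        by (simp add: \<psi>_def taylor_coeff_hasse_deriv prod.distrib mv_taylor_def sum_distrib_left ac_simps)
      moreover have "mv_taylor \<phi> c d y (\<lambda>j. I j + w j) = 0" if "sum I UNIV < M"
        using that by (intro van) (auto simp: M_def sum.distrib)
      moreover have "[:- \<tau>, 1:] ^ M dvd (\<Prod>j\<in>UNIV. H j ^ I j)" if "sum I UNIV \<ge> M"
      proof -
        have "[:- \<tau>, 1:] ^ M dvd [:- \<tau>, 1:] ^ sum I UNIV" using that by (rule le_imp_power_dvd)
        also have "\<dots> = (\<Prod>j\<in>UNIV. [:- \<tau>, 1:] ^ I j)" by (simp add: power_sum)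
        also have "\<dots> dvd (\<Prod>j\<in>UNIV. H j ^ I j)"
          by (intro prod_dvd_prod dvd_power_same H)
        finally show ?thesis .
      qed
      ultimately show "[:- \<tau>, 1:] ^ M dvd smult
         (\<Sum>E\<in>multi_idx d. c E * (\<Prod>j\<in>UNIV. taylor_coeff (\<psi> E j) (y j) (I j)))
         ((\<Prod>j\<in>UNIV. H j ^ I j) * D ^ (d - sum I UNIV))"
        by (cases "sum I UNIV < M") (auto intro: dvd_smult dvd_mult2)
    qed
    finally show ?thesis .
  qed
  have "G = 0"
  proof (rule ccontr)
    assume G: "G \<noteq> 0"
    then have ord: "M \<le> Polynomial.order \<tau> G" if "\<tau> \<in> T" for \<tau>
      using dvd[OF that] by (simp add: order_divides)
    \<comment> \<open>Strictness of \<open>less\<close> excludes \<open>M = 0\<close>, so every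
      element of \<open>T\<close> is a genuine root of \<open>G\<close>.\<close>
    have "M > 0" using less by (cases "M = 0") (auto simp: M_def)
    have "card T * M \<le> (\<Sum>\<tau>\<in>T. Polynomial.order \<tau> G)"
      using sum_mono[OF ord, of T "\<lambda>x. x"] by simp
    also have "\<dots> \<le> (\<Sum>\<tau> | poly G \<tau> = 0. Polynomial.order \<tau> G)"
    proof (rule sum_mono2)
      show "T \<subseteq> {\<tau>. poly G \<tau> = 0}"
        using ord \<open>M > 0\<close> by (force simp: order_root)
    qed auto
    also have "\<dots> \<le> degree G" by (rule sum_order_le_degree[OF G])
    finally show False using degG less by (simp add: M_def)
  qed
  have "poly G t0 = (\<Sum>E\<in>multi_idx d. c E * (poly D t0 ^ (d - sum E UNIV) *
      (\<Prod>j\<in>UNIV. poly D t0 ^ E j * taylor_coeff (\<phi> (E j)) (x j) (w j))))"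
    by (simp add: G_def poly_sum poly_prod poly_homog[OF deg\<psi> x(2)])
      (simp add: \<psi>_def poly_hasse_deriv)
  also have "\<dots> = (\<Sum>E\<in>multi_idx d. poly D t0 ^ d * (c E *
      (\<Prod>j\<in>UNIV. taylor_coeff (\<phi> (E j)) (x j) (w j))))"
  proof (rule sum.cong[OF refl])
    fix E :: "'n \<Rightarrow> nat" assume "E \<in> multi_idx d"
    then have "poly D t0 ^ (d - sum E UNIV) * (\<Prod>j\<in>UNIV. poly D t0 ^ E j) = poly D t0 ^ d"
      by (simp add: multi_idx_def flip: power_sum power_add)
    then show "c E * (poly D t0 ^ (d - sum E UNIV) *
        (\<Prod>j\<in>UNIV. poly D t0 ^ E j * taylor_coeff (\<phi> (E j)) (x j) (w j)))
      = poly D t0 ^ d * (c E * (\<Prod>j\<in>UNIV. taylor_coeff (\<phi> (E j)) (x j) (w j)))"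
      by (simp add: prod.distrib)
  qed
  also have "\<dots> = poly D t0 ^ d * mv_taylor \<phi> c d x w"
    by (simp add: mv_taylor_def sum_distrib_left)
  finally show ?thesis using \<open>G = 0\<close> x(1) by simp
qed

subsection \<open>A basis adapted to multiplicities\<close>

definition newton_basis :: "(nat \<Rightarrow> 'a::field) \<Rightarrow> nat \<Rightarrow> nat \<Rightarrow> 'a poly" where
  "newton_basis a q k = (\<Prod>i<k. [:- a (i mod q), 1:])"

lemma degree_newton_basis_le: "degree (newton_basis a q k) \<le> k"
  using degree_prod_sum_le[of "{..<k}" "\<lambda>i. [:- a (i mod q), 1:]"]
  by (simp add: newton_basis_def)

text \<open>Substituting X + x for X turns (X - x)^s into X^s, which shifts the
  coefficients.\<close>

lemma taylor_coeff_linear_power_mult: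
  "taylor_coeff ([:- x, 1:] ^ s * f) x i = (if i < s then 0 else taylor_coeff f x (i - s))"
proof -
  have "pcompose ([:- x, 1:] ^ s * f) [:x, 1:] = monom 1 s * pcompose f [:x, 1:]"
    by (simp add: pcompose_mult pcompose_power pcompose_pCons monom_altdef)
  then show ?thesis by (simp add: taylor_coeff_def coeff_monom_mult)
qed

text \<open>Collects the factors at the node \<open>a v\<close>; the exponent counts the positions
  below \<open>k\<close> with residue \<open>v\<close>.\<close>

lemma newton_basis_split:
  fixes a :: "nat \<Rightarrow> 'a::field"
  defines "J \<equiv> \<lambda>k v q. {i. i < k \<and> i mod q = v}"
  shows "newton_basis a q k =
    [:- a v, 1:] ^ card (J k v q) * (\<Prod>i\<in>{..<k} - J k v q. [:- a (i mod q), 1:])"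
proof -
  have "newton_basis a q k = (\<Prod>i\<in>{..<k} - J k v q. [:- a (i mod q), 1:]) *
      (\<Prod>i\<in>J k v q. [:- a (i mod q), 1:])"
    unfolding newton_basis_def by (rule prod.subset_diff) (auto simp: J_def)
  also have "(\<Prod>i\<in>J k v q. [:- a (i mod q), 1:]) = (\<Prod>i\<in>J k v q. [:- a v, 1:])"
    by (rule prod.cong) (auto simp: J_def)
  finally show ?thesis by (simp add: mult.commute)
qed

lemma residue_class_below:
  fixes k q :: nat
  assumes "q > 0"
  shows "{i. i < k \<and> i mod q = k mod q} = (\<lambda>t. t * q + k mod q) ` {..<k div q}"
proof (intro equalityI subsetI)
  fix i assume i: "i \<in> {i. i < k \<and> i mod q = k mod q}"
  then have "i = i div q * q + k mod q" by (metis (mono_tags) div_mult_mod_eq mem_Collect_eq)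
  moreover have "i div q < k div q"
  proof (rule ccontr)
    assume "\<not> i div q < k div q"
    then have "k div q * q \<le> i div q * q" by (intro mult_le_mono1) simp
    then have "k div q * q + k mod q \<le> i" using \<open>i = i div q * q + k mod q\<close> by linarith
    then show False using i by simp
  qed
  ultimately show "i \<in> (\<lambda>t. t * q + k mod q) ` {..<k div q}" by blast
next
  fix i assume "i \<in> (\<lambda>t. t * q + k mod q) ` {..<k div q}"
  then obtain t where t: "t < k div q" "i = t * q + k mod q" by auto
  then have "t * q < k div q * q" using assms by simp
  then have "i < k" using t div_mult_mod_eq[of k q] by linarith
  then show "i \<in> {i. i < k \<and> i mod q = k mod q}" using t by simp
qed

lemma card_residue_class_below:
  fixes k q :: nat
  assumes "q > 0"
  shows "card {i. i < k \<and> i mod q = k mod q} = k div q"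
  unfolding residue_class_below[OF assms] using assms
  by (subst card_image) (auto simp: inj_on_def)

text \<open>Position \<open>k\<close> itself contributes a factor to
  \<open>newton_basis a q k'\<close>, so the node \<open>a (k mod q)\<close> occurs there at least
  \<open>Suc (k div q)\<close> times.\<close>

lemma taylor_coeff_newton_basis_eq_0:
  assumes "q > 0" and "k < k'"
  shows "taylor_coeff (newton_basis a q k') (a (k mod q)) (k div q) = 0"
proof -
  have "Suc (k div q) = card (insert k {i. i < k \<and> i mod q = k mod q})"
    using card_residue_class_below[OF assms(1), of k] by simp
  also have "\<dots> \<le> card {i. i < k' \<and> i mod q = k mod q}"
    using assms(2) by (intro card_mono) auto
  finally show ?thesis
    by (subst newton_basis_split[of _ _ _ "k mod q"]) (simp add: taylor_coeff_linear_power_mult)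
qed

text \<open>The node occurs exactly \<open>k div q\<close> times, so this coefficient is the value
  of the cofactor at the node; it is nonzero because the remaining nodes differ from it.\<close>

lemma taylor_coeff_newton_basis_neq_0:
  assumes "q > 0" and "inj_on a {..<q}"
  shows "taylor_coeff (newton_basis a q k) (a (k mod q)) (k div q) \<noteq> 0"
proof -
  have "a (k mod q) \<noteq> a (i mod q)" if "i mod q \<noteq> k mod q" for i
    using assms that by (auto simp: inj_on_def)
  then show ?thesis
    by (subst newton_basis_split[of _ _ _ "k mod q"])
      (auto simp: taylor_coeff_linear_power_mult card_residue_class_below[OF assms(1)]
        taylor_coeff_0 poly_prod)
qed

text \<open>A nonzero polynomial of degree below \<open>l * q\<close> cannot vanish to order
  \<open>l\<close> everywhere: the quotients and remainders modulo \<open>q\<close> of a minimal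
  exponent \<open>E\<close> give the order \<open>w\<close> and the point \<open>x\<close> at which
  only the term of \<open>E\<close> survives.\<close>

lemma ex_mv_taylor_newton_basis_neq_0:
  fixes c :: "('n::finite \<Rightarrow> nat) \<Rightarrow> 'a::field"
  assumes q: "q > 0" and inj: "inj_on a {..<q}" and d: "d < l * q"
    and c: "E0 \<in> multi_idx d" "c E0 \<noteq> 0"
  obtains x w where "sum w UNIV < l" and "mv_taylor (newton_basis a q) c d x w \<noteq> 0"
proof -
  let ?\<phi> = "newton_basis a q"
  \<comment> \<open>Minimal total degree guarantees that every other exponent in the support exceeds
    \<open>E\<close> in some coordinate.\<close>
  obtain E where E: "E \<in> multi_idx d" "c E \<noteq> 0"
    and min: "\<And>E'. E' \<in> multi_idx d \<Longrightarrow> c E' \<noteq> 0 \<Longrightarrow> sum E UNIV \<le> sum E' UNIV"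
    using ex_has_least_nat[of "\<lambda>E. E \<in> multi_idx d \<and> c E \<noteq> 0" E0 "\<lambda>E. sum E UNIV"] c
    by blast
  define x where "x j = a (E j mod q)" for j
  define w where "w j = E j div q" for j
  have "sum w UNIV * q \<le> sum E UNIV"
    by (auto simp: w_def sum_distrib_right intro!: sum_mono)
  also have "\<dots> \<le> d" using E by (simp add: multi_idx_def)
  also note d
  finally have "sum w UNIV < l" by simp
  have "mv_taylor ?\<phi> c d x w = (\<Sum>E'\<in>{E}. c E' * (\<Prod>j\<in>UNIV. taylor_coeff (?\<phi> (E' j)) (x j) (w j)))"
    unfolding mv_taylor_def
  proof (rule sum.mono_neutral_right)
    show "\<forall>E'\<in>multi_idx d - {E}. c E' * (\<Prod>j\<in>UNIV. taylor_coeff (?\<phi> (E' j)) (x j) (w j)) = 0"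
    proof
      fix E' assume E': "E' \<in> multi_idx d - {E}"
      show "c E' * (\<Prod>j\<in>UNIV. taylor_coeff (?\<phi> (E' j)) (x j) (w j)) = 0"
      proof (cases "c E' = 0")
        case False
        have "\<exists>j. E j < E' j"
        proof (rule ccontr)
          assume "\<nexists>j. E j < E' j"
          then have le: "E' j \<le> E j" for j by (simp add: not_less)
          obtain j where "E' j \<noteq> E j" using E' by blast
          then have "sum E' UNIV < sum E UNIV"
            using le by (intro sum_strict_mono_ex1) (auto simp: order.strict_iff_order)
          then show False using min[of E'] E' False by simp
        qed
        then obtain j where "E j < E' j" ..
        then have "taylor_coeff (?\<phi> (E' j)) (x j) (w j) = 0"
          using taylor_coeff_newton_basis_eq_0[OF q] by (simp add: x_def w_def)
        then have "(\<Prod>j\<in>UNIV. taylor_coeff (?\<phi> (E' j)) (x j) (w j)) = 0"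
          by (metis UNIV_I finite prod_zero)
        then show ?thesis by simp
      qed simp
    qed
  qed (use E in auto)
  also have "\<dots> \<noteq> 0"
    using E taylor_coeff_newton_basis_neq_0[OF q inj] by (simp add: x_def w_def)
  finally show ?thesis using that \<open>sum w UNIV < l\<close> by blast
qed

section \<open>Counting conditions against coefficients\<close>

text \<open>More unknowns than linear conditions. Over a finite field the pigeonhole principle
  replaces linear algebra: two coefficient families impose the same data on \<open>Y\<close>, and
  their difference is the solution. Since \<open>m > 0\<close>, the set
  \<open>multi_idx (m - 1)\<close> consists of the orders below \<open>m\<close>.\<close>

lemma ex_vanishing_coeffs:
  fixes Y :: "('n::finite \<Rightarrow> 'a::{field, finite}) set"
  assumes "card Y * card (multi_idx (m - 1) :: ('n \<Rightarrow> nat) set)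
      < card (multi_idx d :: ('n \<Rightarrow> nat) set)"
    and "m > 0"
  obtains c E0 where "E0 \<in> multi_idx d" and "c E0 \<noteq> 0"
    and "\<And>y i. y \<in> Y \<Longrightarrow> sum i UNIV < m \<Longrightarrow> mv_taylor \<phi> c d y i = 0"
proof -
  let ?S = "multi_idx d :: ('n \<Rightarrow> nat) set"
  define B where "B = Y \<times> (multi_idx (m - 1) :: ('n \<Rightarrow> nat) set)"
  define F where "F c = (\<lambda>(y, i)\<in>B. mv_taylor \<phi> c d y i)" for c
  have "finite B" by (simp add: B_def)
  have "card {0, 1 :: 'a} \<le> CARD('a)" by (intro card_mono) auto
  then have "CARD('a) > 1" by simp
  have "card (F ` (?S \<rightarrow>\<^sub>E UNIV)) \<le> card (B \<rightarrow>\<^sub>E (UNIV :: 'a set))"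
    by (intro card_mono finite_PiE \<open>finite B\<close>) (auto simp: F_def)
  also have "\<dots> = CARD('a) ^ card B" by (simp add: card_PiE \<open>finite B\<close>)
  also have "\<dots> < CARD('a) ^ card ?S"
    using assms(1) \<open>CARD('a) > 1\<close>
    by (intro power_strict_increasing) (simp_all add: B_def card_cartesian_product)
  also have "\<dots> = card (?S \<rightarrow>\<^sub>E (UNIV :: 'a set))" by (simp add: card_PiE)
  finally have "\<not> inj_on F (?S \<rightarrow>\<^sub>E UNIV)" by (rule pigeonhole)
  then obtain c1 c2 where c: "c1 \<in> ?S \<rightarrow>\<^sub>E UNIV" "c2 \<in> ?S \<rightarrow>\<^sub>E UNIV" "F c1 = F c2" "c1 \<noteq> c2"
    by (auto simp: inj_on_def)
  then obtain E0 where E0: "E0 \<in> ?S" "c1 E0 \<noteq> c2 E0" by (metis PiE_ext)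
  show ?thesis
  proof (rule that[of E0 "\<lambda>E. c1 E - c2 E"])
    fix y i assume "y \<in> Y" and i: "sum i (UNIV :: 'n set) < m"
    then have "(y, i) \<in> B" using assms(2) by (auto simp: B_def multi_idx_def)
    then have "mv_taylor \<phi> c1 d y i = mv_taylor \<phi> c2 d y i"
      using fun_cong[OF c(3), of "(y, i)"] by (simp add: F_def)
    then show "mv_taylor \<phi> (\<lambda>E. c1 E - c2 E) d y i = 0"
      by (simp add: mv_taylor_def left_diff_distrib sum_subtractf)
  qed (use E0 in auto)
qed

text \<open>Stars and bars: prepending the slack \<open>d - sum E UNIV\<close> turns
  \<open>E\<close> into a list of length \<open>Suc n\<close> with sum exactly
  \<open>d\<close>.\<close>

lemma card_multi_idx: "card (multi_idx d :: ('n::finite \<Rightarrow> nat) set) = (d + CARD('n)) choose CARD('n)"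
proof -
  define n where "n = CARD('n)"
  obtain h :: "nat \<Rightarrow> 'n" where h: "bij_betw h {0..<n} UNIV"
    using ex_bij_betw_nat_finite[of "UNIV :: 'n set"] by (auto simp: n_def)
  define f where "f E = (d - sum E UNIV) # map (\<lambda>i. E (h i)) [0..<n]" for E :: "'n \<Rightarrow> nat"
  have sum_list: "sum_list (map (\<lambda>i. E (h i)) [0..<n]) = sum E UNIV" for E
    by (simp add: interv_sum_list_conv_sum_set_nat sum.reindex_bij_betw[OF h])
  have "bij_betw f (multi_idx d) {l. length l = Suc n \<and> sum_list l = d}"
  proof (rule bij_betw_imageI)
    show "inj_on f (multi_idx d)"
    proof (rule inj_onI)
      fix E E' assume "f E = f E'"
      then have eq: "E (h i) = E' (h i)" if "i < n" for i using that by (auto simp: f_def)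
      show "E = E'"
      proof
        fix j
        have "j \<in> h ` {0..<n}" using h by (simp add: bij_betw_def)
        then obtain i where "i < n" "j = h i" by auto
        then show "E j = E' j" using eq by simp
      qed
    qed
    show "f ` multi_idx d = {l. length l = Suc n \<and> sum_list l = d}"
    proof (intro equalityI subsetI)
      fix l assume "l \<in> f ` multi_idx d"
      then show "l \<in> {l. length l = Suc n \<and> sum_list l = d}"
        by (auto simp: f_def sum_list multi_idx_def)
    next
      fix l :: "nat list" assume "l \<in> {l. length l = Suc n \<and> sum_list l = d}"
      then obtain z zs where l: "l = z # zs" "length zs = n" "z + sum_list zs = d"
        by (cases l) auto
      define E where "E j = zs ! inv_into {0..<n} h j" for j
      have zs: "map (\<lambda>i. E (h i)) [0..<n] = zs"
        using l(2) bij_betw_imp_inj_on[OF h] by (intro nth_equalityI) (auto simp: E_def)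
      have "sum E UNIV = sum_list zs" using sum_list[of E] zs by simp
      then show "l \<in> f ` multi_idx d"
        using l zs by (auto simp: f_def multi_idx_def intro!: image_eqI[of _ _ E])
    qed
  qed
  then have "card (multi_idx d :: ('n \<Rightarrow> nat) set) = (d + Suc n - 1) choose d"
    by (simp only: bij_betw_same_card card_length_sum_list)
  then show ?thesis using binomial_symmetric[of d "d + n"] by (simp add: n_def)
qed

text \<open>Otherwise some nonzero combination vanishes to order \<open>m\<close> on
  \<open>Y\<close>. It has a nonzero Taylor coefficient of order below \<open>l\<close> at some
  \<open>x\<close>, which the curve through \<open>x\<close> forces to be zero.\<close>

lemma card_multi_idx_le:
  fixes Y :: "('n::finite \<Rightarrow> 'a::{field, finite}) set"
  assumes curve: "\<And>x. \<exists>A D t0 T. (\<forall>j. degree (A j) \<le> e) \<and> degree D \<le> e \<and> poly D t0 \<noteq> 0 \<and>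
      (\<forall>j. poly (A j) t0 = x j * poly D t0) \<and> r \<le> card T \<and>
      (\<forall>\<tau>\<in>T. \<exists>y\<in>Y. \<forall>j. poly (A j) \<tau> = y j * poly D \<tau>)"
    and d: "d < l * CARD('a)" and r: "e * d < r * (m + 1 - l)" and "m > 0"
  shows "card (multi_idx d :: ('n \<Rightarrow> nat) set)
    \<le> card Y * card (multi_idx (m - 1) :: ('n \<Rightarrow> nat) set)"
proof (rule ccontr)
  obtain a :: "nat \<Rightarrow> 'a" where a: "bij_betw a {..<CARD('a)} UNIV"
    using ex_bij_betw_nat_finite[of "UNIV :: 'a set"] by (auto simp: atLeast0LessThan)
  define \<phi> where "\<phi> = newton_basis a CARD('a)"
  assume "\<not> ?thesis"
  then obtain c and E0 :: "'n \<Rightarrow> nat" where c: "E0 \<in> multi_idx d" "c E0 \<noteq> 0"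
    and van: "\<And>y i. y \<in> Y \<Longrightarrow> sum i UNIV < m \<Longrightarrow> mv_taylor \<phi> c d y i = 0"
    using ex_vanishing_coeffs[of Y m d \<phi>] \<open>m > 0\<close> by (metis not_le)
  have "CARD('a) > 0" by simp
  then obtain x w where w: "sum w UNIV < l" and nz: "mv_taylor \<phi> c d x w \<noteq> 0"
    using ex_mv_taylor_newton_basis_neq_0[of "CARD('a)" a d l E0 c thesis] c d
      bij_betw_imp_inj_on[OF a] unfolding \<phi>_def by metis
  obtain A D t0 T where AD: "\<And>j. degree (A j) \<le> e" "degree D \<le> e" "poly D t0 \<noteq> 0"
      "\<And>j. poly (A j) t0 = x j * poly D t0" "r \<le> card T"
    and T: "\<And>\<tau>. \<tau> \<in> T \<Longrightarrow> \<exists>y\<in>Y. \<forall>j. poly (A j) \<tau> = y j * poly D \<tau>"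
    using curve[of x] by blast
  \<comment> \<open>As \<open>sum w UNIV\<close> is at most \<open>l - 1\<close>, at least
    \<open>m - (l - 1)\<close> of the multiplicity remains.\<close>
  have "r * (m + 1 - l) \<le> card T * (m - sum w UNIV)"
    using AD(5) w by (intro mult_mono) auto
  with r have "e * d < card T * (m - sum w UNIV)" by linarith
  moreover have "\<exists>y. (\<forall>j. poly (A j) \<tau> = y j * poly D \<tau>) \<and>
      (\<forall>i. sum i UNIV < m \<longrightarrow> mv_taylor \<phi> c d y i = 0)" if "\<tau> \<in> T" for \<tau>
    using T[OF that] van by blast
  ultimately have "mv_taylor \<phi> c d x w = 0"
    using AD by (intro mv_taylor_eq_0_on_curve[of \<phi> A e D T m c d t0 x w])
      (auto simp: \<phi>_def degree_newton_basis_le)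
  with nz show False by contradiction
qed

subsection \<open>Rational parametrisations of conics\<close>

lemma lin_indep_pairD:
  assumes "lin_indep_pair b c" and "u *s b + v *s c = 0"
  shows "u = 0" and "v = 0"
proof -
  have bc: "b \<noteq> c" "vec.independent {b, c}" using assms(1) by (auto simp: lin_indep_pair_def)
  then have "b \<notin> vec.span {c}" "vec.independent {c}"
    by (auto simp: vec.independent_insert)
  then have "c \<noteq> 0" using vec.dependent_zero by blast
  show "u = 0"
  proof (rule ccontr)
    assume u: "u \<noteq> 0"
    have "b = (inverse u * - v) *s c"
    proof -
      have "u *s b = (- v) *s c" using assms(2) by (simp add: eq_neg_iff_add_eq_0)
      then have "inverse u *s (u *s b) = inverse u *s ((- v) *s c)" by simp
      then show ?thesis using u by (simp only: vector_smult_assoc) simp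
    qed
    then have "b \<in> vec.span {c}" by (metis insertI1 vec.span_base vec.span_scale)
    with \<open>b \<notin> vec.span {c}\<close> show False by contradiction
  qed
  then show "v = 0" using assms(2) \<open>c \<noteq> 0\<close> by simp
qed

lemma lin_indep_pair_cancel:
  assumes "lin_indep_pair b c" and "a + u *s b + v *s c = a + u' *s b + v' *s c"
  shows "u = u'" and "v = v'"
proof -
  have "(u - u') *s b + (v - v') *s c = 0"
    using assms(2) by (simp add: vec.scale_left_diff_distrib algebra_simps)
  from lin_indep_pairD[OF assms(1) this] show "u = u'" "v = v'" by auto
qed

text \<open>The curve A / D passes through \<open>x\<close> at \<open>t0\<close> and meets
  \<open>S\<close> at the parameters in \<open>T\<close>; incidences are multiplied by
  \<open>D\<close> to avoid division.\<close>

definition quad_param ::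
  "('n::finite \<Rightarrow> 'a::field poly) \<Rightarrow> 'a poly \<Rightarrow> 'a \<Rightarrow> 'a set \<Rightarrow> 'a ^ 'n \<Rightarrow> ('a ^ 'n) set \<Rightarrow> bool" where
  "quad_param A D t0 T x S \<longleftrightarrow> (\<forall>j. degree (A j) \<le> 2) \<and> degree D \<le> 2 \<and> poly D t0 \<noteq> 0 \<and>
     (\<forall>j. poly (A j) t0 = x $ j * poly D t0) \<and>
     (\<forall>\<tau>\<in>T. \<exists>y\<in>S. \<forall>j. poly (A j) \<tau> = y $ j * poly D \<tau>)"

lemma degree_quadratic_le: "degree [:a, b, c:] \<le> 2"
  by (simp add: degree_pCons_eq_if)

text \<open>Multiplying by \<open>t\<close> gives numerators c + a t + b t^2 over the denominator
  \<open>t\<close>. Two parameters are lost, the pole 0 and \<open>t0\<close>, which is the source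
  of \<open>q - 2\<close>.\<close>

lemma hyperbola_param:
  fixes x :: "'a::{field, finite} ^ 'n"
  assumes "is_hyperbola C" and "x \<in> C"
  shows "\<exists>A D t0 T. quad_param A D t0 T x (C - {x}) \<and> CARD('a) - 2 \<le> card T"
proof -
  obtain a b c where bc: "lin_indep_pair b c"
    and C: "C = {a + t *s b + inverse t *s c | t. t \<noteq> 0}"
    using assms(1) by (auto simp: is_hyperbola_def)
  obtain t0 where t0: "t0 \<noteq> 0" "x = a + t0 *s b + inverse t0 *s c" using assms(2) C by blast
  have val: "poly [:c $ j, a $ j, b $ j:] t = (a + t *s b + inverse t *s c) $ j * t"
    if "t \<noteq> 0" for t j
    using that by (simp add: field_simps)
  have "quad_param (\<lambda>j. [:c $ j, a $ j, b $ j:]) [:0, 1:] t0 (UNIV - {0, t0}) x (C - {x})"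
    unfolding quad_param_def
  proof (intro conjI allI ballI)
    fix \<tau> assume \<tau>: "\<tau> \<in> UNIV - {0, t0}"
    define y where "y = a + \<tau> *s b + inverse \<tau> *s c"
    have "y \<noteq> x" using lin_indep_pair_cancel(1)[OF bc] \<tau> t0 by (auto simp: y_def)
    then have "y \<in> C - {x}" using \<tau> by (auto simp: C y_def)
    moreover have "\<forall>j. poly [:c $ j, a $ j, b $ j:] \<tau> = y $ j * poly [:0, 1:] \<tau>"
      using val \<tau> by (simp add: y_def)
    ultimately show "\<exists>y\<in>C - {x}. \<forall>j. poly [:c $ j, a $ j, b $ j:] \<tau> = y $ j * poly [:0, 1:] \<tau>"
      by blast
  next
    fix j show "poly [:c $ j, a $ j, b $ j:] t0 = x $ j * poly [:0, 1:] t0"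
      using val[OF t0(1)] t0(2) by simp
  qed (use t0 in \<open>auto simp: degree_quadratic_le\<close>)
  moreover have "CARD('a) - 2 \<le> card (UNIV - {0, t0})"
    using t0(1) by (subst card_Diff_subset) auto
  ultimately show ?thesis by blast
qed

lemma parabola_param:
  fixes x :: "'a::{field, finite} ^ 'n"
  assumes "is_parabola C" and "x \<in> C"
  shows "\<exists>A D t0 T. quad_param A D t0 T x (C - {x}) \<and> CARD('a) - 2 \<le> card T"
proof -
  obtain a b c where bc: "lin_indep_pair b c" and C: "C = {a + t *s b + t\<^sup>2 *s c | t. True}"
    using assms(1) by (auto simp: is_parabola_def)
  obtain t0 where t0: "x = a + t0 *s b + t0\<^sup>2 *s c" using assms(2) C by blast
  have val: "poly [:a $ j, b $ j, c $ j:] t = (a + t *s b + t\<^sup>2 *s c) $ j" for t j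
    by (simp add: algebra_simps power2_eq_square)
  have "quad_param (\<lambda>j. [:a $ j, b $ j, c $ j:]) 1 t0 (UNIV - {t0}) x (C - {x})"
    unfolding quad_param_def
  proof (intro conjI allI ballI)
    fix \<tau> assume \<tau>: "\<tau> \<in> UNIV - {t0}"
    define y where "y = a + \<tau> *s b + \<tau>\<^sup>2 *s c"
    have "y \<noteq> x" using lin_indep_pair_cancel(1)[OF bc] \<tau> t0 by (auto simp: y_def)
    then have "y \<in> C - {x}" by (auto simp: C y_def)
    moreover have "\<forall>j. poly [:a $ j, b $ j, c $ j:] \<tau> = y $ j * poly 1 \<tau>"
      using val by (simp add: y_def)
    ultimately show "\<exists>y\<in>C - {x}. \<forall>j. poly [:a $ j, b $ j, c $ j:] \<tau> = y $ j * poly 1 \<tau>"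
      by blast
  next
    fix j show "poly [:a $ j, b $ j, c $ j:] t0 = x $ j * poly 1 t0"
      using val t0 by simp
  qed (auto simp: degree_quadratic_le)
  moreover have "card (UNIV - {t0}) = CARD('a) - 1" by (subst card_Diff_subset) auto
  ultimately show ?thesis by (metis diff_le_mono2 one_le_numeral)
qed

text \<open>In characteristic 2 squaring is injective, hence surjective on a finite field, and no
  nonsquare exists.\<close>

lemma nonsquare_two_neq_0:
  fixes g :: "'a::{field, finite}"
  assumes "\<nexists>s. g = s\<^sup>2"
  shows "(2 :: 'a) \<noteq> 0"
proof
  assume two: "(2 :: 'a) = 0"
  have "inj (\<lambda>s :: 'a. s\<^sup>2)"
  proof (rule injI)
    fix s t :: 'a assume "s\<^sup>2 = t\<^sup>2"
    then have "(s - t)\<^sup>2 = 2 * (t\<^sup>2 - s * t)" by (simp add: power2_eq_square algebra_simps)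
    then have "(s - t)\<^sup>2 = 0" by (simp only: two mult_zero_left)
    then show "s = t" by simp
  qed
  then have "surj (\<lambda>s :: 'a. s\<^sup>2)" by (rule finite_UNIV_inj_surj[OF finite])
  then show False using assms by (meson surjD)
qed

text \<open>With \<open>r = sqrt g\<close>, the ellipse is the set of \<open>y + x r\<close> of norm \<open>k\<close>; it is parametrised by
  multiplying the given point with \<open>- (s + r)\<^sup>2 / (s\<^sup>2 - g)\<close>, which has norm \<open>1\<close>.\<close>

lemma ellipse_param:
  fixes x :: "'a::{field, finite} ^ 'n"
  assumes g: "\<nexists>s. g = s\<^sup>2" and "is_ellipse g C" and "x \<in> C"
  shows "\<exists>A D t0 T. quad_param A D t0 T x (C - {x}) \<and> CARD('a) - 2 \<le> card T"
proof -
  have two: "(2 :: 'a) \<noteq> 0" by (rule nonsquare_two_neq_0[OF g])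
  have g0: "g \<noteq> 0" using g by (metis zero_power2)
  obtain a b c k where bc: "lin_indep_pair b c" and "k \<noteq> 0"
    and C: "C = {a + x *s b + y *s c | x y. y\<^sup>2 = g * x\<^sup>2 + k}"
    using assms(2) by (auto simp: is_ellipse_def)
  obtain x0 y0 where xy: "y0\<^sup>2 = g * x0\<^sup>2 + k" "x = a + x0 *s b + y0 *s c"
    using assms(3) C by blast
  \<comment> \<open>In (s + r)^2 (y0 + x0 r) the coefficient of \<open>r\<close> is \<open>X\<close>
    and the remaining part is \<open>Y\<close>. The denominator g - s^2 has no root as
    \<open>g\<close> is not a square, and s = 0 gives multiplier 1, hence the point
    \<open>x\<close>.\<close>
  define X where "X = [:g * x0, 2 * y0, x0:]"
  define Y where "Y = [:g * y0, 2 * g * x0, y0:]"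
  define D where "D = [:g, 0, - 1:]"
  define A where "A j = smult (a $ j) D + smult (b $ j) X + smult (c $ j) Y" for j
  have D: "poly D s \<noteq> 0" for s using g by (auto simp: D_def power2_eq_square)
  have norm: "(poly Y s)\<^sup>2 = g * (poly X s)\<^sup>2 + k * (poly D s)\<^sup>2" for s
  proof -
    \<comment> \<open>Multiplicativity of the norm: (s + r)^2 has norm (s^2 - g)^2.\<close>
    have "(poly Y s)\<^sup>2 - g * (poly X s)\<^sup>2 = (y0\<^sup>2 - g * x0\<^sup>2) * (poly D s)\<^sup>2"
      unfolding X_def Y_def D_def by (simp add: power2_eq_square algebra_simps)
    then show ?thesis using xy(1) by (simp add: algebra_simps)
  qed
  define P where "P s = a + (poly X s / poly D s) *s b + (poly Y s / poly D s) *s c" for s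
  have val: "poly (A j) s = P s $ j * poly D s" for j s
    using D[of s] by (simp add: A_def P_def distrib_right)
  have P: "P s \<in> C" for s
  proof -
    have "(poly Y s / poly D s)\<^sup>2 = g * (poly X s / poly D s)\<^sup>2 + k"
      using D[of s] norm[of s] by (simp add: power_divide add_divide_distrib)
    then show ?thesis unfolding P_def C by blast
  qed
  have P0: "P 0 = x" using g0 by (simp add: P_def xy(2) X_def Y_def D_def)
  have neq: "P s \<noteq> x" if s: "s \<noteq> 0" for s
  proof
    assume "P s = x"
    then have "poly X s / poly D s = x0" "poly Y s / poly D s = y0"
      using lin_indep_pair_cancel[OF bc] unfolding P_def xy(2) by blast+
    then have "poly X s = x0 * poly D s" "poly Y s = y0 * poly D s" using D[of s] by (auto simp: field_simps)
    \<comment> \<open>These are X - x0 D and Y - y0 D. Cancelling 2 s leads to x0 = y0 = 0, contrary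
      to k being nonzero.\<close>
    then have "2 * s * (y0 + x0 * s) = 0" "2 * s * (g * x0 + y0 * s) = 0"
      by (simp_all add: X_def Y_def D_def algebra_simps)
    then have y0: "y0 + x0 * s = 0" "g * x0 + y0 * s = 0" using s two by auto
    then have "y0 = - (x0 * s)" by (simp add: eq_neg_iff_add_eq_0)
    with y0(2) have "x0 * (g - s * s) = 0" by (simp add: algebra_simps)
    moreover have "g - s * s \<noteq> 0" using g by (auto simp: power2_eq_square)
    ultimately have "x0 = 0" by simp
    with \<open>y0 = - (x0 * s)\<close> xy(1) \<open>k \<noteq> 0\<close> show False by simp
  qed
  have "quad_param A D 0 (UNIV - {0}) x (C - {x})"
    unfolding quad_param_def
  proof (intro conjI allI ballI)
    fix j
    have "degree X \<le> 2" "degree Y \<le> 2" "degree D \<le> 2"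
      by (simp_all only: X_def Y_def D_def degree_quadratic_le)
    then show "degree (A j) \<le> 2" "degree D \<le> 2"
      unfolding A_def by (auto intro!: degree_add_le order_trans[OF degree_smult_le])
    show "poly (A j) 0 = x $ j * poly D 0" using val[of j 0] P0 by simp
  next
    fix \<tau> :: 'a assume "\<tau> \<in> UNIV - {0}"
    then show "\<exists>y\<in>C - {x}. \<forall>j. poly (A j) \<tau> = y $ j * poly D \<tau>"
      using P neq val by blast
  qed (rule D)
  moreover have "card (UNIV - {0 :: 'a}) = CARD('a) - 1" by (subst card_Diff_subset) auto
  ultimately show ?thesis by (metis diff_le_mono2 one_le_numeral)
qed

section \<open>Limits of ratios of binomial coefficients\<close>

text \<open>The \<open>- 1\<close> makes each binomial coefficient a rising factorial starting at
  \<open>K * Suc s\<close>, divided by \<open>n!\<close>. The ratio is then a product of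
  \<open>n\<close> factors, each tending to A / B.\<close>

lemma tendsto_binomial_ratio:
  fixes A B n :: nat
  assumes "A > 0" and "B > 0"
  shows "(\<lambda>s. real ((A * Suc s - 1 + n) choose n) / real ((B * Suc s - 1 + n) choose n))
    \<longlonglongrightarrow> (real A / real B) ^ n"
proof -
  have choose: "real ((K * Suc s - 1 + n) choose n)
      = (\<Prod>i<n. real K * real (Suc s) + real i) / fact n" if "K > 0" for K s
  proof -
    have "real (K * Suc s - 1 + n) - real n + 1 = real K * real (Suc s)"
      using that by (simp add: of_nat_diff Suc_le_eq algebra_simps)
    then show ?thesis
      by (simp only: binomial_gbinomial gbinomial_pochhammer' pochhammer_prod atLeast0LessThan)
  qed
  have "(\<lambda>s. \<Prod>i<n. (real A * real (Suc s) + real i) / (real B * real (Suc s) + real i))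
      \<longlonglongrightarrow> (\<Prod>i<n. real A / real B)"
  proof (rule tendsto_prod)
    fix i
    have "(\<lambda>s. (real A + real i / real (Suc s)) / (real B + real i / real (Suc s)))
        \<longlonglongrightarrow> (real A + 0) / (real B + 0)"
      using assms LIMSEQ_Suc[OF lim_const_over_n[of "real i"]]
      by (intro tendsto_intros) auto
    moreover have "(real A + real i / real (Suc s)) / (real B + real i / real (Suc s))
        = (real A * real (Suc s) + real i) / (real B * real (Suc s) + real i)" for s
    proof -
      have "(real A * real (Suc s) + real i) / (real B * real (Suc s) + real i)
          = ((real A + real i / real (Suc s)) * real (Suc s)) /
            ((real B + real i / real (Suc s)) * real (Suc s))"
        by (simp add: distrib_right del: of_nat_Suc)
      then show ?thesis by (simp del: of_nat_Suc)
    qed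
    ultimately show "(\<lambda>s. (real A * real (Suc s) + real i) / (real B * real (Suc s) + real i))
        \<longlonglongrightarrow> real A / real B" by simp
  qed
  then show ?thesis
    by (simp add: choose[OF assms(1)] choose[OF assms(2)] prod_dividef del: of_nat_Suc mult_Suc_right One_nat_def)
qed

subsection \<open>The lower bound\<close>

lemma card_conical_Nikodym_set_ge:
  fixes g :: "'a::{field, finite}" and N :: "('a ^ 'n) set"
  assumes g: "\<nexists>s. g = s\<^sup>2" and N: "conical_Nikodym_set g N"
    and q: "CARD('a) = q" "q \<ge> 3"
  shows "(real (q * (q - 2)) / real (3 * q - 2)) ^ CARD('n) \<le> real (card N)"
proof -
  define Y where "Y = vec_nth ` N"
  have "inj_on vec_nth N" by (simp add: inj_on_def vec_nth_inject)
  then have cardY: "card Y = card N" unfolding Y_def by (rule card_image)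
  have curve: "\<exists>A D t0 T. (\<forall>j. degree (A j) \<le> 2) \<and> degree D \<le> 2 \<and> poly D t0 \<noteq> 0 \<and>
      (\<forall>j. poly (A j) t0 = x j * poly D t0) \<and> q - 2 \<le> card T \<and>
      (\<forall>\<tau>\<in>T. \<exists>y\<in>Y. \<forall>j. poly (A j) \<tau> = y j * poly D \<tau>)" for x :: "'n \<Rightarrow> 'a"
  proof -
    let ?x = "\<chi> j. x j"
    obtain C where C: "is_hyperbola C \<or> is_parabola C \<or> is_ellipse g C" "?x \<in> C" "C - {?x} \<subseteq> N"
      using N unfolding conical_Nikodym_set_def by blast
    then obtain A D t0 T where qp: "quad_param A D t0 T ?x (C - {?x})" and T: "q - 2 \<le> card T"
      using hyperbola_param parabola_param ellipse_param[OF g] q(1) by blast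
    have "\<exists>y\<in>Y. \<forall>j. poly (A j) \<tau> = y j * poly D \<tau>" if "\<tau> \<in> T" for \<tau>
      using qp that C(3) unfolding quad_param_def Y_def by blast
    moreover have "\<forall>j. poly (A j) t0 = x j * poly D t0"
      using qp by (simp add: quad_param_def)
    ultimately show ?thesis
      using qp T unfolding quad_param_def by blast
  qed
  \<comment> \<open>The parameters are d = a s - 1, m = b s and l = (q - 2) s, with
    \<open>Suc s\<close> for s. The choice b = (q - 2) + 2 q gives (q - 2) (m - l) = 2 l q = 2 (d +
    1).\<close>
  define a where "a = q * (q - 2)"
  define b where "b = 3 * q - 2"
  have ab: "a > 0" "b > 0" using q(2) by (auto simp: a_def b_def)
  have bound: "real ((a * Suc s - 1 + CARD('n)) choose CARD('n)) /
      real ((b * Suc s - 1 + CARD('n)) choose CARD('n)) \<le> real (card N)" for s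
  proof -
    let ?l = "(q - 2) * Suc s"
    have b: "b = (q - 2) + 2 * q" using q(2) by (simp add: b_def)
    have "a * Suc s > 0" "b * Suc s > 0" using ab by simp_all
    have "a * Suc s = ?l * q" by (simp only: a_def ac_simps)
    then have d: "a * Suc s - 1 < ?l * CARD('a)" using \<open>a * Suc s > 0\<close> q(1) by simp
    have "b * Suc s = ?l + 2 * q * Suc s" unfolding b by (simp only: add_mult_distrib)
    then have "b * Suc s + 1 - ?l = 2 * q * Suc s + 1" by simp
    then have "(q - 2) * (b * Suc s + 1 - ?l) = 2 * (a * Suc s) + (q - 2)"
      by (simp only: a_def add_mult_distrib2 mult_1_right ac_simps)
    moreover have "2 * (a * Suc s - 1) < 2 * (a * Suc s)" using \<open>a * Suc s > 0\<close> by linarith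
    ultimately have r: "2 * (a * Suc s - 1) < (q - 2) * (b * Suc s + 1 - ?l)" by linarith
    have "card (multi_idx (a * Suc s - 1) :: ('n \<Rightarrow> nat) set)
        \<le> card Y * card (multi_idx (b * Suc s - 1) :: ('n \<Rightarrow> nat) set)"
      by (rule card_multi_idx_le[OF curve d r \<open>b * Suc s > 0\<close>])
    then have "real ((a * Suc s - 1 + CARD('n)) choose CARD('n))
        \<le> real (card N) * real ((b * Suc s - 1 + CARD('n)) choose CARD('n))"
      unfolding card_multi_idx cardY of_nat_mult[symmetric] of_nat_le_iff .
    moreover have "(b * Suc s - 1 + CARD('n)) choose CARD('n) > 0" by simp
    ultimately show ?thesis by (simp only: pos_divide_le_eq of_nat_0_less_iff)
  qed
  \<comment> \<open>\<open>card N\<close> does not depend on \<open>s\<close>, so it also bounds the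
    limit (a / b)^n.\<close>
  show ?thesis
    using tendsto_upperbound[OF tendsto_binomial_ratio[OF ab, of "CARD('n)"]] bound
    by (simp add: a_def b_def)
qed

theorem theorem2:
  fixes g :: "'a::{field, finite}" and N :: "('a ^ 'n) set" and p k q n :: nat
  assumes "prime p" and "odd p" and "k \<ge> 1" and "q = p ^ k" and "CARD('a) = q"
    and "CARD('n) = n" and "n \<ge> 2"
    and "g \<noteq> 0" and "\<nexists>s. g = s\<^sup>2"
    and "conical_Nikodym_set g N"
  shows "real (card N) \<ge> (3 + 4 / (real q - 2)) powi (- int n) * real q ^ n
    \<and> (\<exists>\<epsilon> :: nat \<Rightarrow> real. \<epsilon> \<in> o(\<lambda>_. 1) \<and>
         (\<forall>r>2. \<forall>m. (3 + 4 / (real r - 2)) powi (- int m) * real r ^ m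
                    = (3 + \<epsilon> r) powi (- int m) * real r ^ m))"
proof
  have "p \<ge> 3"
    using prime_ge_2_nat[OF assms(1)] assms(2) by (cases "p = 2") auto
  then have q: "q \<ge> 3"
    using assms(3,4) self_le_power[of p k] by simp
  \<comment> \<open>The inverse of this fraction, multiplied by \<open>q\<close>, is the base a / b
    of the bound just proved.\<close>
  have "3 + 4 / (real q - 2) = real (3 * q - 2) / (real q - 2)"
    using q by (simp add: field_simps of_nat_diff)
  then have "(3 + 4 / (real q - 2)) powi (- int n) * real q ^ n
      = ((real q - 2) / real (3 * q - 2)) ^ n * real q ^ n"
    by (simp add: power_int_minus power_divide)
  also have "\<dots> = (real (q * (q - 2)) / real (3 * q - 2)) ^ n"
    using q by (simp add: of_nat_diff ac_simps flip: power_mult_distrib)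
  also have "\<dots> \<le> real (card N)"
    using card_conical_Nikodym_set_ge[OF assms(9,10,5) q] assms(6) by simp
  finally show "(3 + 4 / (real q - 2)) powi (- int n) * real q ^ n \<le> real (card N)" .
  \<comment> \<open>With this \<epsilon> the two expressions coincide literally, so only its decay
    has to be shown.\<close>
  have "(\<lambda>r. 4 / (real r - 2)) \<in> o(\<lambda>_. 1)"
    by real_asymp
  then show "\<exists>\<epsilon> :: nat \<Rightarrow> real. \<epsilon> \<in> o(\<lambda>_. 1) \<and>
         (\<forall>r>2. \<forall>m. (3 + 4 / (real r - 2)) powi (- int m) * real r ^ m
                    = (3 + \<epsilon> r) powi (- int m) * real r ^ m)"
    by blast
qed

end
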